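(* For every (fixed) graph $F$ there is a constant $c>0$ such that the following holds. Let $a,b,m,n$ be positive integers with $n\ge 2$ and $a \geq 2^{12}(\log n)^3$ such that there exists an $\mathcal{L}(F)$-free $(m,n,a,b)$-graph. If $t = 2^8 n(\log n)^2/(ab)$, then $$r(F,t) \ge c\,\frac{bt}{\log n}.$$
   Context: All graphs are finite and simple, and $\log$ is to base $2$. Ramsey number: for a graph $F$ and an integer $t\ge 2$, $r(F,t)$ is the minimum $N$ such that every $N$-vertex $F$-free graph (no subgraph isomorphic to $F$, not necessarily induced) contains an independent set of order $t$. For non-integer $t$, $r(F,t)$ is read as $r(F,\lceil t\rceil)$. An $m$ by $n$ bipartite graph is a bipartite graph with designated parts of orders $m$ and $n$. An $(m,n,a,b)$-graph is an $m$ by $n$ bipartite graph with $n\ge m$ such that all vertices in the part of size $n$ have degree $a$ and all vertices in the part of size $m$ have degree $b\ge a$. The family $\mathcal{L}(F)$: let $\mathcal{E}(F)$ be the set of sequences $H=(H_1,\dots,H_k)$ (for any integer $k\ge 0$) of edge-disjoint bipartite subgraphs of $F$, each containing at least one edge, such that the sets $E(H_i)$ partition $E(F)$ and $|V(H_i)\cap V(H_j)|\le 1$ for all $1\le i<j\le k$. For $H=(H_1,\dots,H_k)\in\mathcal{E}(F)$, let $J(H)$ be the bipartite graph with parts $[k]=\{1,\dots,k\}$ and $V(F)$ in which $i\in[k]$ is adjacent to exactly the vertices in $V(H_i)\subseteq V(F)$. Then $\mathcal{L}(F)=\{J(H): H\in\mathcal{E}(F)\}\cup\{C_4\}$, where $C_4$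 is the 4-cycle. An $m$ by $n$ bipartite graph is $\mathcal{L}(F)$-free if it contains no $C_4$ and, for every $H=(H_1,\dots,H_k)\in\mathcal{E}(F)$, it contains no copy (as a not necessarily induced subgraph) of $J(H)$ in which the part $[k]$ is embedded in the part of order $m$ and the part $V(F)$ is embedded in the part of order $n$. *)

theory Defs
  imports Complex_Main "HOL-Library.Ramsey"
begin

record 'a ugraph =
  verts :: "'a set"
  edges :: "'a set set"

definition simple_graph :: "'a ugraph \<Rightarrow> bool" where
  "simple_graph G \<longleftrightarrow> finite (verts G) \<and> edges G \<subseteq> [verts G]\<^bsup>2\<^esup>"

definition vertex_degree :: "'a ugraph \<Rightarrow> 'a \<Rightarrow> nat" where
  "vertex_degree G v = card {e \<in> edges G. v \<in> e}"

definition subgraph :: "'a ugraph \<Rightarrow> 'a ugraph \<Rightarrow> bool" where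
  "subgraph H G \<longleftrightarrow> simple_graph H \<and> verts H \<subseteq> verts G \<and> edges H \<subseteq> edges G"

(* phi embeds H in G as a not necessarily induced subgraph. *)
definition embedding :: "('a \<Rightarrow> 'b) \<Rightarrow> 'a ugraph \<Rightarrow> 'b ugraph \<Rightarrow> bool" where
  "embedding \<phi> H G \<longleftrightarrow>
     inj_on \<phi> (verts H) \<and> \<phi> ` verts H \<subseteq> verts G \<and> (\<forall>e \<in> edges H. \<phi> ` e \<in> edges G)"

definition contains_copy :: "'b ugraph \<Rightarrow> 'a ugraph \<Rightarrow> bool" where
  "contains_copy G H \<longleftrightarrow> (\<exists>\<phi>. embedding \<phi> H G)"

(* Every finite graph is isomorphic to one whose vertices are natural numbers, so it
   is enough to let G range over graphs of that type.  The minimum exists: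
   see ramsey_number_exists. *)
definition ramsey_number :: "'a ugraph \<Rightarrow> nat \<Rightarrow> nat" where
  "ramsey_number F t =
     (LEAST N. \<forall>G :: nat ugraph.
        simple_graph G \<and> card (verts G) = N \<and> \<not> contains_copy G F \<longrightarrow>
        (\<exists>S \<subseteq> verts G. card S = t \<and> indep S (edges G)))"

definition ramsey_number_real :: "'a ugraph \<Rightarrow> real \<Rightarrow> nat" where
  "ramsey_number_real F t = ramsey_number F (nat \<lceil>t\<rceil>)"

definition bipartite_graph :: "'a set \<Rightarrow> 'a set \<Rightarrow> 'a ugraph \<Rightarrow> bool" where
  "bipartite_graph A B G \<longleftrightarrow>
     simple_graph G \<and> verts G = A \<union> B \<and> A \<inter> B = {} \<and>
     (\<forall>e \<in> edges G. \<exists>x \<in> A. \<exists>y \<in> B. e = {x, y})"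

definition is_bipartite :: "'a ugraph \<Rightarrow> bool" where
  "is_bipartite G \<longleftrightarrow> (\<exists>A B. bipartite_graph A B G)"

(* An (m,n,a,b)-graph whose part of order m is A and whose part of order n is B. *)
definition mnab_graph ::
    "nat \<Rightarrow> nat \<Rightarrow> nat \<Rightarrow> nat \<Rightarrow> 'a set \<Rightarrow> 'a set \<Rightarrow> 'a ugraph \<Rightarrow> bool" where
  "mnab_graph m n a b A B G \<longleftrightarrow>
     bipartite_graph A B G \<and> card A = m \<and> card B = n \<and> m \<le> n \<and> a \<le> b \<and>
     (\<forall>v \<in> B. vertex_degree G v = a) \<and> (\<forall>u \<in> A. vertex_degree G u = b)"

(* The set E(F).  The members of a sequence may have isolated vertices, and the empty
   sequence is admitted when F has no edges. *)
definition bipartite_decomps :: "'a ugraph \<Rightarrow> 'a ugraph list set" where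
  "bipartite_decomps F = {Hs.
     (\<forall>H \<in> set Hs. subgraph H F \<and> is_bipartite H \<and> edges H \<noteq> {}) \<and>
     (\<Union>H \<in> set Hs. edges H) = edges F \<and>
     (\<forall>i j. i < j \<and> j < length Hs \<longrightarrow>
        edges (Hs ! i) \<inter> edges (Hs ! j) = {} \<and>
        card (verts (Hs ! i) \<inter> verts (Hs ! j)) \<le> 1)}"

(* J(H): the part [k] becomes Inl ` {..<k}, the part V(F) becomes Inr ` V(F). *)
definition J_graph :: "'a ugraph \<Rightarrow> 'a ugraph list \<Rightarrow> (nat + 'a) ugraph" where
  "J_graph F Hs =
     \<lparr>verts = Inl ` {..<length Hs} \<union> Inr ` verts F,
      edges = {{Inl i, Inr v} | i v. i < length Hs \<and> v \<in> verts (Hs ! i)}\<rparr>"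

definition C4 :: "nat ugraph" where
  "C4 = \<lparr>verts = {0, 1, 2, 3}, edges = {{0, 1}, {1, 2}, {2, 3}, {3, 0}}\<rparr>"

(* G is a bipartite graph with parts A (of order m) and B (of order n).  A copy of J(H)
   counts only if it respects the parts, so swapping A and B changes the meaning. *)
definition L_free :: "'a ugraph \<Rightarrow> 'b set \<Rightarrow> 'b set \<Rightarrow> 'b ugraph \<Rightarrow> bool" where
  "L_free F A B G \<longleftrightarrow>
     \<not> contains_copy G C4 \<and>
     (\<forall>Hs \<in> bipartite_decomps F.
        \<not> (\<exists>\<phi>. embedding \<phi> (J_graph F Hs) G \<and>
               \<phi> ` Inl ` {..<length Hs} \<subseteq> A \<and> \<phi> ` Inr ` verts F \<subseteq> B))"

lemma clique_imp_contains_copy: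
  assumes F: "simple_graph F" and R: "R \<subseteq> verts G" "finite R" "card R = card (verts F)"
    and cl: "clique R (edges G)"
  shows "contains_copy G F"
proof -
  obtain \<phi> where bij: "bij_betw \<phi> (verts F) R"
    using F R finite_same_card_bij[of "verts F" R] by (auto simp: simple_graph_def)
  have "\<phi> ` e \<in> edges G" if "e \<in> edges F" for e
  proof -
    have "e \<in> [verts F]\<^bsup>2\<^esup>"
      using F that by (auto simp: simple_graph_def)
    then obtain x y where xy: "e = {x, y}" "x \<in> verts F" "y \<in> verts F" "x \<noteq> y"
      by (rule nsets2_E)
    then have "\<phi> x \<in> R" "\<phi> y \<in> R" "\<phi> x \<noteq> \<phi> y"
      using bij by (auto simp: bij_betw_def inj_on_def)
    then show ?thesis
      using cl xy by (auto simp: clique_def)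
  qed
  then show ?thesis
    using bij R unfolding contains_copy_def embedding_def bij_betw_def by blast
qed

lemma ramsey_number_exists:
  assumes F: "simple_graph F"
  shows "\<exists>N. \<forall>G :: nat ugraph.
           simple_graph G \<and> card (verts G) = N \<and> \<not> contains_copy G F \<longrightarrow>
           (\<exists>S \<subseteq> verts G. card S = t \<and> indep S (edges G))"
proof -
  obtain N where N: "\<And>(V :: nat set) E. finite V \<Longrightarrow> card V \<ge> N \<Longrightarrow>
      \<exists>R \<subseteq> V. card R = card (verts F) \<and> clique R E \<or> card R = t \<and> indep R E"
    using ramsey2[of "card (verts F)" t] by metis
  show ?thesis
  proof (intro exI[of _ N] allI impI)
    fix G :: "nat ugraph"
    assume G: "simple_graph G \<and> card (verts G) = N \<and> \<not> contains_copy G F"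
    then have fin: "finite (verts G)"
      by (simp add: simple_graph_def)
    obtain R where "R \<subseteq> verts G"
      "card R = card (verts F) \<and> clique R (edges G) \<or> card R = t \<and> indep R (edges G)"
      using N[OF fin, of "edges G"] G by auto
    then show "\<exists>S \<subseteq> verts G. card S = t \<and> indep S (edges G)"
      using clique_imp_contains_copy[OF F] finite_subset[OF _ fin] G by blast
  qed
qed

end

theory Submission
  imports Defs "HOL-Analysis.Convex"
begin

text \<open>
  The vertices of the part \<open>B\<close> of order \<open>n\<close> become the vertices of a new graph.  For every
  \<open>u\<close> in the other part \<open>A\<close>, split the neighbourhood of \<open>u\<close> into two sets and join all pairs
  across the split.  There is no 4-cycle, so these complete bipartite graphs are edge-disjoint and
  any two share at most one vertex.  A copy of \<open>F\<close> in their union would be decomposed by them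
  into a member \<open>H\<close> of the family of bipartite decompositions of \<open>F\<close>, and \<open>J(H)\<close> would appear
  in the given graph; so the union is \<open>F\<close>-free (lemma \<open>split_graph_F_free\<close>).

  If the splits are random, then with positive probability every set \<open>S\<close> of more than
  \<open>R = 64 n / b\<close> vertices contains a vertex that is joined to at least \<open>\<beta> |S|\<close> vertices of
  \<open>S\<close>, where \<open>\<beta> = a b / (64 n)\<close> (lemmas \<open>exists_balanced_bipartitions\<close> and
  \<open>exists_vertex_of_large_degree\<close>).  Concentration of the number of edges inside
  \<open>S\<close> would be spoilt by a few large traces on \<open>S\<close>.  Instead, the union bound runs over the
  set of those \<open>u\<close> that split their trace on \<open>S\<close> unevenly: it is unlikely that these carry half of the incidences with
  \<open>S\<close>, and the other half yields enough edges by the Cauchy-Schwarz inequality.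

  The Kleitman-Winston method (lemma \<open>weighted_indep_bound\<close>) then shows that there are at most
  \<open>(8 / x)\<^bsup>T\<^esup>\<close> independent sets of order \<open>T = \<lceil>t\<rceil>\<close>, where \<open>x = t / R\<close>.  A random
  set of at most \<open>x n / 16 = b t / 1024\<close> vertices contains fewer than one of them on average
  (lemma \<open>exists_subset_avoiding\<close>), so some induced subgraph of this order has no independent set
  of order \<open>T\<close>.  This bounds the Ramsey number below by \<open>b t / 1024\<close>.
\<close>

section \<open>Balanced cuts of a set system\<close>

lemma sum_prod_Pow:
  fixes w :: "'v \<Rightarrow> real"
  assumes "finite N"
  shows "(\<Sum>C\<in>Pow N. \<Prod>v\<in>C. w v) = (\<Prod>v\<in>N. 1 + w v)"
  using prod_add[OF assms, of w "\<lambda>_. 1"] by (simp add: add.commute)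

text \<open>A set \<^term>\<open>C\<close> cuts \<^term>\<open>X\<close> badly if one of the two sides \<^term>\<open>X \<inter> C\<close> and \<^term>\<open>X - C\<close>
  holds less than an eighth of \<^term>\<open>X\<close>.  A balanced cut has at least \<open>|X|\<^sup>2 / 16\<close> crossing pairs.\<close>

definition unbalanced :: "'v set \<Rightarrow> 'v set \<Rightarrow> bool" where
  "unbalanced X C \<longleftrightarrow> 8 * card (X \<inter> C) < card X \<or> 8 * card (X - C) < card X"

text \<open>The proportion of subsets of \<^term>\<open>N\<close> that meet \<^term>\<open>X\<close> in few points is at most
  \<open>(4/5)\<^bsup>|X|\<^esup>\<close>, by the exponential moment method: the indicator of
  \<open>8 |X \<inter> C| < |X|\<close> is at most \<open>(3/2)\<^bsup>|X|\<^esup> (1/16)\<^bsup>|X \<inter> C|\<^esup>\<close>, and the latter weight is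
  multiplicative in \<^term>\<open>C\<close>.\<close>

lemma card_sparse_subsets:
  assumes "finite N" "X \<subseteq> N"
  shows "real (card {C \<in> Pow N. 8 * card (X \<inter> C) < card X}) \<le> (4/5) ^ card X * 2 ^ card N"
proof -
  define w :: "'a \<Rightarrow> real" where "w = (\<lambda>v. if v \<in> X then 1/16 else 1)"
  have w_prod: "(\<Prod>v\<in>C. w v) = (1/16) ^ card (X \<inter> C)" if "C \<subseteq> N" for C
  proof -
    have "finite C" using that assms finite_subset by blast
    then have "(\<Prod>v\<in>C. w v) = (\<Prod>v\<in>C \<inter> X. 1/16)"
      unfolding w_def by (subst prod.inter_restrict) auto
    then show ?thesis by (simp add: Int_commute)
  qed
  have "real (card {C \<in> Pow N. 8 * card (X \<inter> C) < card X})
      = (\<Sum>C\<in>{C \<in> Pow N. 8 * card (X \<inter> C) < card X}. 1)"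
    by simp
  also have "\<dots> \<le> (\<Sum>C\<in>{C \<in> Pow N. 8 * card (X \<inter> C) < card X}. (3/2) ^ card X * (\<Prod>v\<in>C. w v))"
  proof (rule sum_mono)
    fix C assume C: "C \<in> {C \<in> Pow N. 8 * card (X \<inter> C) < card X}"
    have "(16::real) ^ card (X \<inter> C) \<le> ((3/2) ^ 8) ^ card (X \<inter> C)"
      by (intro power_mono) (simp_all add: power_divide)
    also have "\<dots> \<le> (3/2) ^ card X"
      unfolding power_mult[symmetric] using C by (intro power_increasing) auto
    finally have "1 \<le> (3/2) ^ card X / (16::real) ^ card (X \<inter> C)"
      by (subst le_divide_eq_1_pos) auto
    then show "1 \<le> (3/2) ^ card X * (\<Prod>v\<in>C. w v)"
      using C by (simp add: w_prod power_one_over)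
  qed
  also have "\<dots> \<le> (\<Sum>C\<in>Pow N. (3/2) ^ card X * (\<Prod>v\<in>C. w v))"
    using assms by (intro sum_mono2) (auto intro!: mult_nonneg_nonneg prod_nonneg simp: w_def)
  also have "\<dots> = (3/2) ^ card X * (\<Prod>v\<in>N. 1 + w v)"
    using assms by (simp add: sum_distrib_left[symmetric] sum_prod_Pow)
  also have "(\<Prod>v\<in>N. 1 + w v) = (\<Prod>v\<in>N. (if v \<in> X then 17/32 else 1) * 2)"
    by (intro prod.cong) (auto simp: w_def)
  also have "\<dots> = (17/32) ^ card X * 2 ^ card N"
  proof -
    have "(\<Prod>v\<in>N. if v \<in> X then 17/32 else (1::real)) = (\<Prod>v\<in>N \<inter> X. 17/32)"
      using assms by (subst prod.inter_restrict) auto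
    then show ?thesis
      using assms by (simp add: prod.distrib Int_absorb1)
  qed
  also have "(3/2) ^ card X * ((17/32) ^ card X * 2 ^ card N) = (51/64::real) ^ card X * 2 ^ card N"
    by (simp flip: power_mult_distrib mult.assoc)
  also have "\<dots> \<le> (4/5) ^ card X * 2 ^ card N"
    by (intro mult_right_mono power_mono) auto
  finally show ?thesis .
qed

lemma card_unbalanced:
  assumes "finite N" "X \<subseteq> N"
  shows "real (card {C \<in> Pow N. unbalanced X C}) \<le> 2 * (4/5) ^ card X * 2 ^ card N"
proof -
  let ?L = "{C \<in> Pow N. 8 * card (X \<inter> C) < card X}"
  \<comment> \<open>Complementation in \<^term>\<open>N\<close> swaps the two ways of being unbalanced.\<close>
  have "{C \<in> Pow N. unbalanced X C} \<subseteq> ?L \<union> (\<lambda>C. N - C) ` ?L"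
  proof
    fix C assume C: "C \<in> {C \<in> Pow N. unbalanced X C}"
    have "X \<inter> (N - C) = X - C" "N - (N - C) = C"
      using assms C by auto
    then show "C \<in> ?L \<union> (\<lambda>C. N - C) ` ?L"
      using C unfolding unbalanced_def image_iff by (auto intro!: bexI[of _ "N - C"])
  qed
  then have "card {C \<in> Pow N. unbalanced X C} \<le> card (?L \<union> (\<lambda>C. N - C) ` ?L)"
    using assms by (intro card_mono) auto
  also have "\<dots> \<le> card ?L + card ?L"
    using assms by (intro card_Un_le[THEN order_trans] add_left_mono card_image_le) auto
  finally show ?thesis
    using card_sparse_subsets[OF assms] by simp
qed

lemma sum_card_incidence:
  assumes "finite A" "finite S"
  shows "(\<Sum>u\<in>A. card {v \<in> S. r u v}) = (\<Sum>v\<in>S. card {u \<in> A. r u v})"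
proof -
  have "(\<Sum>u\<in>A. card {v \<in> S. r u v}) = (\<Sum>u\<in>A. \<Sum>v\<in>S. if r u v then 1 else 0)"
    using assms by (simp add: sum.If_cases Int_def)
  also have "\<dots> = (\<Sum>v\<in>S. \<Sum>u\<in>A. if r u v then 1 else 0)"
    by (rule sum.swap)
  also have "\<dots> = (\<Sum>v\<in>S. card {u \<in> A. r u v})"
    using assms by (simp add: sum.If_cases Int_def)
  finally show ?thesis .
qed

text \<open>The cuts of the different sets \<^term>\<open>Nb u\<close> are independent.  So the probability that every
  \<^term>\<open>u\<close> in a given set \<^term>\<open>U\<close> is unbalanced on \<^term>\<open>S\<close> is a product; it decays with the total
  size of the traces of these \<^term>\<open>Nb u\<close> on \<^term>\<open>S\<close>, however that size is distributed over
  \<^term>\<open>U\<close>.\<close>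

lemma card_many_unbalanced:
  fixes Nb :: "'u \<Rightarrow> 'v set"
  assumes "finite A" and fin: "\<And>u. u \<in> A \<Longrightarrow> finite (Nb u)" and "U \<subseteq> A"
  shows "real (card {f \<in> (\<Pi>\<^sub>E u\<in>A. Pow (Nb u)). \<forall>u\<in>U. unbalanced (Nb u \<inter> S) (f u)})
    \<le> 2 ^ card A * (4/5) ^ (\<Sum>u\<in>U. card (Nb u \<inter> S)) * real (card (\<Pi>\<^sub>E u\<in>A. Pow (Nb u)))"
proof -
  define T where "T = (\<lambda>u. {C \<in> Pow (Nb u). u \<in> U \<longrightarrow> unbalanced (Nb u \<inter> S) C})"
  have "{f \<in> (\<Pi>\<^sub>E u\<in>A. Pow (Nb u)). \<forall>u\<in>U. unbalanced (Nb u \<inter> S) (f u)} = (\<Pi>\<^sub>E u\<in>A. T u)"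
    using assms(3) unfolding T_def PiE_iff set_eq_iff by blast
  then have "real (card {f \<in> (\<Pi>\<^sub>E u\<in>A. Pow (Nb u)). \<forall>u\<in>U. unbalanced (Nb u \<inter> S) (f u)})
      = (\<Prod>u\<in>A. real (card (T u)))"
    using assms(1) by (simp add: card_PiE)
  also have "\<dots> \<le> (\<Prod>u\<in>A. 2 * (if u \<in> U then (4/5) ^ card (Nb u \<inter> S) else 1) * 2 ^ card (Nb u))"
  proof (intro prod_mono conjI)
    fix u assume u: "u \<in> A"
    show "real (card (T u)) \<le> 2 * (if u \<in> U then (4/5) ^ card (Nb u \<inter> S) else 1) * 2 ^ card (Nb u)"
    proof (cases "u \<in> U")
      case True
      then show ?thesis using card_unbalanced[OF fin[OF u], of "Nb u \<inter> S"] by (simp add: T_def)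
    next
      case False
      then have "T u = Pow (Nb u)" by (auto simp: T_def)
      then show ?thesis using False fin[OF u] by (simp add: card_Pow)
    qed
  qed auto
  also have "\<dots> = 2 ^ card A * (\<Prod>u\<in>A. if u \<in> U then (4/5) ^ card (Nb u \<inter> S) else 1)
      * (\<Prod>u\<in>A. 2 ^ card (Nb u))"
    by (simp add: prod.distrib)
  also have "(\<Prod>u\<in>A. if u \<in> U then (4/5::real) ^ card (Nb u \<inter> S) else 1)
      = (\<Prod>u\<in>A \<inter> U. (4/5) ^ card (Nb u \<inter> S))"
    using assms(1) by (subst prod.inter_restrict) auto
  also have "A \<inter> U = U" using assms(3) by blast
  also have "(\<Prod>u\<in>U. (4/5::real) ^ card (Nb u \<inter> S)) = (4/5) ^ (\<Sum>u\<in>U. card (Nb u \<inter> S))"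
    by (simp add: power_sum)
  also have "(\<Prod>u\<in>A. (2::real) ^ card (Nb u)) = real (card (\<Pi>\<^sub>E u\<in>A. Pow (Nb u)))"
    using assms(1) fin by (simp add: card_PiE card_Pow)
  finally show ?thesis .
qed

text \<open>The cuts \<^term>\<open>f u\<close> of the sets \<^term>\<open>Nb u\<close> can be chosen so that on every large
  \<^term>\<open>S\<close> the unbalanced indices account for less than half of the \<open>a |S|\<close> incidences with
  \<^term>\<open>S\<close>.  This is a union bound over \<^term>\<open>S\<close> and over the sets \<^term>\<open>U\<close> of indices that could
  carry half of the incidences.  For one pair the probability is at most
  \<open>2\<^bsup>m\<^esup> (4/5)\<^bsup>a|S|/2\<^esup>\<close>, where \<open>m\<close> is the size of \<^term>\<open>A\<close>.  The condition
  \<open>64 m \<le> a |S|\<close> pays for the at most \<open>2\<^bsup>m\<^esup>\<close> choices of \<^term>\<open>U\<close>, and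
  \<open>a \<ge> 2\<^bsup>12\<^esup> log n\<close> for the choice of \<^term>\<open>S\<close>.\<close>

lemma exists_balanced_bipartitions:
  fixes Nb :: "'u \<Rightarrow> 'v set"
  assumes "finite A" "finite B" and sub: "\<And>u. u \<in> A \<Longrightarrow> Nb u \<subseteq> B"
    and deg: "\<And>v. v \<in> B \<Longrightarrow> card {u \<in> A. v \<in> Nb u} = a"
    and "card B \<ge> 2" and large: "real a \<ge> 2 ^ 12 * log 2 (real (card B))"
  shows "\<exists>f. (\<forall>u\<in>A. f u \<subseteq> Nb u) \<and> (\<forall>S\<subseteq>B. S \<noteq> {} \<longrightarrow> 64 * card A \<le> a * card S \<longrightarrow>
    2 * (\<Sum>u | u \<in> A \<and> unbalanced (Nb u \<inter> S) (f u). card (Nb u \<inter> S)) < a * card S)"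
proof -
  let ?\<Omega> = "\<Pi>\<^sub>E u\<in>A. Pow (Nb u)"
  let ?n = "real (card B)" and ?L = "log 2 (real (card B))"
  define Ss where "Ss = {S. S \<subseteq> B \<and> S \<noteq> {} \<and> 64 * card A \<le> a * card S}"
  define Us where "Us = (\<lambda>S. {U. U \<subseteq> A \<and> a * card S \<le> 2 * (\<Sum>u\<in>U. card (Nb u \<inter> S))})"
  define Bad where "Bad = (\<lambda>S U. {f \<in> ?\<Omega>. \<forall>u\<in>U. unbalanced (Nb u \<inter> S) (f u)})"
  have finN: "finite (Nb u)" if "u \<in> A" for u
    using sub[OF that] assms(2) finite_subset by blast
  have fin\<Omega>: "finite ?\<Omega>" using assms(1) finN by (intro finite_PiE) auto
  have pos\<Omega>: "card ?\<Omega> > 0" using assms(1) finN by (simp add: card_PiE card_Pow prod_pos)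
  have finSs: "finite Ss"
    unfolding Ss_def by (rule finite_subset[of _ "Pow B"]) (use assms(2) in auto)
  have finUs: "finite (Us S)" for S
    unfolding Us_def by (rule finite_subset[of _ "Pow A"]) (use assms(1) in auto)
  have finBad: "finite (Bad S U)" for S U
    unfolding Bad_def by (rule finite_subset[OF _ fin\<Omega>]) auto
  have one: "real (card (Bad S U)) \<le> 2 powr (- real (card A) - 3 * real (card S) * ?L) * card ?\<Omega>"
    if S: "S \<in> Ss" and U: "U \<in> Us S" for S U
  proof -
    let ?x = "\<Sum>u\<in>U. card (Nb u \<inter> S)"
    have m: "64 * real (card A) \<le> real a * card S"
      using S of_nat_mono[of "64 * card A" "a * card S", where ?'a = real] unfolding Ss_def by simp
    have x: "real a * card S \<le> 2 * real ?x"
      using U of_nat_mono[of "a * card S" "2 * ?x", where ?'a = real] unfolding Us_def by simp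
    have "2 ^ 12 * ?L * card S \<le> real a * card S"
      using large by (intro mult_right_mono) auto
    then have l: "4096 * (card S * ?L) \<le> real a * card S"
      by (simp add: mult_ac)
    \<comment> \<open>This holds since \<open>(4/5)\<^sup>4 < 1/2\<close>.\<close>
    have "(4/5::real) \<le> 2 powr (-1/4)"
    proof (rule power_le_imp_le_base[of _ 3])
      have eq: "(2 powr (-1/4)) ^ Suc 3 = (1/2 :: real)"
        by (subst powr_power) (auto simp: powr_minus)
      show "(4/5::real) ^ Suc 3 \<le> (2 powr (-1/4)) ^ Suc 3"
        unfolding eq by (simp add: power_divide)
    qed auto
    then have "(4/5::real) ^ ?x \<le> (2 powr (-1/4)) ^ ?x"
      by (intro power_mono) auto
    also have "\<dots> = 2 powr (- real ?x / 4)"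
      by (simp add: powr_power)
    finally have p: "(4/5::real) ^ ?x \<le> 2 powr (- real ?x / 4)" .
    have "real (card (Bad S U)) \<le> 2 ^ card A * (4/5) ^ ?x * real (card ?\<Omega>)"
      unfolding Bad_def using U assms(1) finN by (intro card_many_unbalanced) (auto simp: Us_def)
    also have "\<dots> \<le> 2 ^ card A * 2 powr (- real ?x / 4) * real (card ?\<Omega>)"
      using p by (intro mult_right_mono mult_left_mono) auto
    also have "2 ^ card A * 2 powr (- real ?x / 4) = (2::real) powr (card A - real ?x / 4)"
      by (simp add: powr_add[symmetric] flip: powr_realpow)
    also have "2 powr (card A - real ?x / 4) * real (card ?\<Omega>)
        \<le> 2 powr (- real (card A) - 3 * real (card S) * ?L) * card ?\<Omega>"
      using m x l by (intro mult_right_mono powr_mono) auto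
    finally show ?thesis .
  qed
  have "real (card (\<Union>S\<in>Ss. \<Union>U\<in>Us S. Bad S U)) \<le> (\<Sum>S\<in>Ss. real (card (\<Union>U\<in>Us S. Bad S U)))"
    using card_UN_le[OF finSs] by (simp flip: of_nat_sum)
  also have "\<dots> \<le> (\<Sum>S\<in>Ss. \<Sum>U\<in>Us S. real (card (Bad S U)))"
    using card_UN_le[OF finUs] by (intro sum_mono) (simp flip: of_nat_sum)
  also have "\<dots> \<le> (\<Sum>S\<in>Ss. \<Sum>U\<in>Us S. 2 powr (- real (card A) - 3 * real (card S) * ?L) * card ?\<Omega>)"
    by (intro sum_mono one)
  also have "\<dots> = (\<Sum>S\<in>Ss. card (Us S) * 2 powr (- real (card A) - 3 * real (card S) * ?L)) * card ?\<Omega>"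
    by (simp add: sum_distrib_right mult.assoc)
  also have "\<dots> \<le> (\<Sum>S\<in>Ss. (1 / ?n ^ 3) ^ card S) * card ?\<Omega>"
  proof (intro mult_right_mono sum_mono)
    fix S
    have "card (Us S) \<le> card (Pow A)"
      unfolding Us_def using assms(1) by (intro card_mono) auto
    then have "real (card (Us S)) \<le> 2 powr card A"
      using assms(1) of_nat_mono[of "card (Us S)" "2 ^ card A", where ?'a = real]
      by (simp add: card_Pow powr_realpow)
    then have "card (Us S) * 2 powr (- real (card A) - 3 * real (card S) * ?L)
        \<le> 2 powr card A * 2 powr (- real (card A) - 3 * real (card S) * ?L)"
      by (intro mult_right_mono) auto
    also have "\<dots> = (2 powr ?L) powr (- 3 * real (card S))"
      by (simp add: powr_powr flip: powr_add) (simp add: mult_ac)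
    also have "2 powr ?L = ?n" using assms(5) by simp
    also have "?n powr (- 3 * real (card S)) = (1 / ?n ^ 3) ^ card S"
    proof -
      have "?n powr (- 3 * real (card S)) = ?n powr (- real (3 * card S))" by simp
      also have "\<dots> = 1 / ?n ^ (3 * card S)"
        using assms(5) by (subst powr_minus_divide, subst powr_realpow) auto
      finally show ?thesis by (simp add: power_mult power_one_over)
    qed
    finally show "card (Us S) * 2 powr (- real (card A) - 3 * real (card S) * ?L) \<le> (1 / ?n ^ 3) ^ card S" .
  qed auto
  also have "\<dots> < 1 * real (card ?\<Omega>)"
  proof (intro mult_strict_right_mono)
    \<comment> \<open>The empty set, which is not in \<^term>\<open>Ss\<close>, contributes 1; so it is enough that the whole sum is below 2.\<close>
    have "(\<Sum>S\<in>insert {} Ss. (1 / ?n ^ 3) ^ card S) \<le> (\<Sum>S\<in>Pow B. \<Prod>v\<in>S. 1 / ?n ^ 3)"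
      unfolding prod_constant by (rule sum_mono2) (use assms(2) in \<open>auto simp: Ss_def\<close>)
    also have "\<dots> = (1 + 1 / ?n ^ 3) ^ card B"
      using sum_prod_Pow[OF assms(2), of "\<lambda>_. 1 / ?n ^ 3"] by simp
    also have "\<dots> \<le> exp (1 / ?n ^ 3) ^ card B"
      by (intro power_mono exp_ge_add_one_self) auto
    also have "\<dots> = exp (1 / ?n ^ 2)"
      using assms(5) by (simp flip: exp_of_nat_mult add: power3_eq_cube power2_eq_square)
    also have "\<dots> \<le> exp (1 / 2)"
    proof -
      have "2 ^ 2 \<le> ?n ^ 2" using assms(5) by (intro power_mono) auto
      then show ?thesis by (simp add: divide_simps)
    qed
    also have "\<dots> < 2"
    proof -
      have "exp (1/2 :: real) ^ 2 = exp 1" by (simp flip: exp_of_nat_mult)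
      also have "\<dots> < 2 ^ 2" using exp_le by simp
      finally show ?thesis by (rule power_less_imp_less_base) auto
    qed
    finally show "(\<Sum>S\<in>Ss. (1 / ?n ^ 3) ^ card S) < 1"
      using finSs by (subst (asm) sum.insert) (auto simp: Ss_def)
  qed (use pos\<Omega> in auto)
  finally have "card (\<Union>S\<in>Ss. \<Union>U\<in>Us S. Bad S U) < card ?\<Omega>" by simp
  then obtain f where f: "f \<in> ?\<Omega>" "f \<notin> (\<Union>S\<in>Ss. \<Union>U\<in>Us S. Bad S U)"
    using card_mono[of "\<Union>S\<in>Ss. \<Union>U\<in>Us S. Bad S U" ?\<Omega>] finSs finUs finBad by fastforce
  show ?thesis
  proof (intro exI[of _ f] conjI allI impI ballI)
    show "f u \<subseteq> Nb u" if "u \<in> A" for u using f(1) that by (auto simp: PiE_iff)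
    fix S assume S: "S \<subseteq> B" "S \<noteq> {}" "64 * card A \<le> a * card S"
    let ?U = "{u. u \<in> A \<and> unbalanced (Nb u \<inter> S) (f u)}"
    have "?U \<notin> Us S" using f S unfolding Ss_def Bad_def by blast
    then show "2 * (\<Sum>u\<in>?U. card (Nb u \<inter> S)) < a * card S"
      unfolding Us_def by auto
  qed
qed

text \<open>Join two points when some \<^term>\<open>f u\<close> separates them inside \<^term>\<open>Nb u\<close>.  The
  Cauchy-Schwarz inequality over the balanced indices gives at least \<open>a\<^sup>2 |S|\<^sup>2 / (64 m)\<close>
  separated pairs inside \<^term>\<open>S\<close>, no pair being counted for two indices because the sets
  \<^term>\<open>Nb u\<close> share at most one point.  So some vertex of \<^term>\<open>S\<close> has degree at least the
  average \<open>a\<^sup>2 |S| / (64 m)\<close>.\<close>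

lemma exists_vertex_of_large_degree:
  fixes Nb :: "'u \<Rightarrow> 'v set"
  assumes "finite A" "finite S" "S \<noteq> {}"
    and deg: "\<And>v. v \<in> S \<Longrightarrow> card {u \<in> A. v \<in> Nb u} = a"
    and lin: "\<And>u u' x y. u \<in> A \<Longrightarrow> u' \<in> A \<Longrightarrow> {x, y} \<subseteq> Nb u \<Longrightarrow> {x, y} \<subseteq> Nb u' \<Longrightarrow> x \<noteq> y \<Longrightarrow> u = u'"
    and f: "\<And>u. u \<in> A \<Longrightarrow> f u \<subseteq> Nb u"
    and bal: "2 * (\<Sum>u | u \<in> A \<and> unbalanced (Nb u \<inter> S) (f u). card (Nb u \<inter> S)) < a * card S"
  shows "\<exists>v\<in>S. a\<^sup>2 * card S \<le> 64 * card A * card {w \<in> S. \<exists>u\<in>A. v \<in> f u \<and> w \<in> Nb u - f u}"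
proof (rule ccontr)
  assume "\<not> ?thesis"
  then have lt: "64 * card A * card {w \<in> S. \<exists>u\<in>A. v \<in> f u \<and> w \<in> Nb u - f u} < a\<^sup>2 * card S"
    if "v \<in> S" for v using that by (simp add: not_le)
  let ?G = "{u. u \<in> A \<and> \<not> unbalanced (Nb u \<inter> S) (f u)}"
  let ?P = "\<lambda>u. (Nb u \<inter> S \<inter> f u) \<times> (Nb u \<inter> S - f u)"
  have finG: "finite ?G" using assms(1) by simp
  have total: "(\<Sum>u\<in>A. card (Nb u \<inter> S)) = a * card S"
  proof -
    have "(\<Sum>u\<in>A. card (Nb u \<inter> S)) = (\<Sum>u\<in>A. card {v \<in> S. v \<in> Nb u})"
      by (intro sum.cong arg_cong[of _ _ card]) auto
    also have "\<dots> = (\<Sum>v\<in>S. a)"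
      using sum_card_incidence[OF assms(1,2), of "\<lambda>u v. v \<in> Nb u"] deg by simp
    finally show ?thesis by (simp add: mult.commute)
  qed
  have "(\<Sum>u\<in>A. card (Nb u \<inter> S)) = (\<Sum>u\<in>?G \<union> {u. u \<in> A \<and> unbalanced (Nb u \<inter> S) (f u)}. card (Nb u \<inter> S))"
    by (intro sum.cong) auto
  also have "\<dots> = (\<Sum>u\<in>?G. card (Nb u \<inter> S)) + (\<Sum>u | u \<in> A \<and> unbalanced (Nb u \<inter> S) (f u). card (Nb u \<inter> S))"
    using assms(1) by (intro sum.union_disjoint) auto
  finally have good: "a * card S \<le> 2 * (\<Sum>u\<in>?G. card (Nb u \<inter> S))"
    using bal total by linarith
  have P: "(card (Nb u \<inter> S))\<^sup>2 \<le> 16 * card (?P u)" if "u \<in> ?G" for u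
  proof -
    let ?i = "card (Nb u \<inter> S \<inter> f u)" and ?d = "card (Nb u \<inter> S - f u)"
    have x: "card (Nb u \<inter> S) = ?i + ?d"
      using assms(2) by (subst card_Int_Diff[of _ "f u"]) auto
    have "?i + ?d \<le> 8 * ?i" "?i + ?d \<le> 8 * ?d"
      using that x unfolding unbalanced_def by auto
    moreover have "(p + q)\<^sup>2 \<le> 16 * (p * q)" if "p + q \<le> 8 * p" "p + q \<le> 8 * q" for p q :: nat
    proof (cases "p \<le> q")
      case True
      then have "(p + q) * (p + q) \<le> (8 * p) * (2 * q)" using that by (intro mult_mono) auto
      then show ?thesis by (simp add: power2_eq_square)
    next
      case False
      then have "(p + q) * (p + q) \<le> (2 * p) * (8 * q)" using that by (intro mult_mono) auto
      then show ?thesis by (simp add: power2_eq_square)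
    qed
    ultimately show ?thesis unfolding x by (simp add: card_cartesian_product)
  qed
  \<comment> \<open>Ordered pairs with first entry in \<^term>\<open>f u\<close> are counted.\<close>
  have "(a * card S)\<^sup>2 \<le> (2 * (\<Sum>u\<in>?G. card (Nb u \<inter> S)))\<^sup>2"
    using good by (intro power_mono) auto
  also have "\<dots> = 4 * (\<Sum>u\<in>?G. card (Nb u \<inter> S))\<^sup>2" by (simp add: power_mult_distrib)
  also have "(\<Sum>u\<in>?G. card (Nb u \<inter> S))\<^sup>2 \<le> (\<Sum>u\<in>?G. (card (Nb u \<inter> S))\<^sup>2) * card ?G"
  proof -
    have "real ((\<Sum>u\<in>?G. card (Nb u \<inter> S))\<^sup>2) \<le> real ((\<Sum>u\<in>?G. (card (Nb u \<inter> S))\<^sup>2) * card ?G)"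
      using sum_squared_le_sum_of_squares[of "\<lambda>u. real (card (Nb u \<inter> S))" ?G]
      by (simp add: mult.commute)
    then show ?thesis by (simp only: of_nat_le_iff)
  qed
  also have "\<dots> \<le> (\<Sum>u\<in>?G. 16 * card (?P u)) * card A"
    using assms(1) P by (intro mult_mono sum_mono card_mono) auto
  also have "(\<Sum>u\<in>?G. 16 * card (?P u)) = 16 * card (\<Union>u\<in>?G. ?P u)"
  proof -
    have "?P u \<inter> ?P u' = {}" if "u \<in> ?G" "u' \<in> ?G" "u \<noteq> u'" for u u'
      using lin[of u u'] that by auto
    then have "card (\<Union>u\<in>?G. ?P u) = (\<Sum>u\<in>?G. card (?P u))"
      using finG assms(2) by (intro card_UN_disjoint) auto
    then show ?thesis by (simp add: sum_distrib_left)
  qed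
  also have "card (\<Union>u\<in>?G. ?P u) \<le> card (SIGMA v:S. {w \<in> S. \<exists>u\<in>A. v \<in> f u \<and> w \<in> Nb u - f u})"
    using assms(2) by (intro card_mono) auto
  also have "\<dots> = (\<Sum>v\<in>S. card {w \<in> S. \<exists>u\<in>A. v \<in> f u \<and> w \<in> Nb u - f u})"
    using assms(2) by (subst card_SigmaI) auto
  finally have "(a * card S)\<^sup>2 \<le> (\<Sum>v\<in>S. 64 * card A * card {w \<in> S. \<exists>u\<in>A. v \<in> f u \<and> w \<in> Nb u - f u})"
    by (simp add: sum_distrib_left mult_ac)
  also have "\<dots> < (\<Sum>v\<in>S. a\<^sup>2 * card S)"
    using assms lt by (intro sum_strict_mono) auto
  finally show False by (simp add: power2_eq_square mult_ac)
qed


section \<open>The split graph\<close>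

text \<open>The neighbourhood of a vertex.\<close>

definition nbhd :: "'v ugraph \<Rightarrow> 'v \<Rightarrow> 'v set" where
  "nbhd G u = {v. {u, v} \<in> edges G}"

text \<open>The graph that results when the clique on the neighbourhood of each \<^term>\<open>u \<in> A\<close> is replaced by
  the complete bipartite graph between \<^term>\<open>f u\<close> and its complement in the neighbourhood.\<close>

definition split_edges :: "'v ugraph \<Rightarrow> 'v set \<Rightarrow> ('v \<Rightarrow> 'v set) \<Rightarrow> 'v set set" where
  "split_edges G A f = {{x, y} | x y. \<exists>u\<in>A. x \<in> f u \<and> y \<in> nbhd G u - f u}"

lemma split_edges_iff:
  "{v, w} \<in> split_edges G A f \<longleftrightarrow>
     (\<exists>u\<in>A. v \<in> f u \<and> w \<in> nbhd G u - f u \<or> w \<in> f u \<and> v \<in> nbhd G u - f u)"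
  unfolding split_edges_def by (auto simp: doubleton_eq_iff)

lemma bipartite_nbhd:
  assumes "bipartite_graph A B G" "u \<in> A"
  shows "nbhd G u \<subseteq> B"
  using assms unfolding bipartite_graph_def nbhd_def by (fastforce simp: doubleton_eq_iff)

lemma C4_free_linear:
  assumes G: "bipartite_graph A B G" and C4: "\<not> contains_copy G C4"
    and u: "u \<in> A" "u' \<in> A" "u \<noteq> u'"
    and x: "{x, y} \<subseteq> nbhd G u" "{x, y} \<subseteq> nbhd G u'"
  shows "x = y"
proof (rule ccontr)
  assume "x \<noteq> y"
  have B: "x \<in> B" "y \<in> B" using bipartite_nbhd[OF G u(1)] x by auto
  have AB: "A \<inter> B = {}" "verts G = A \<union> B" using G by (auto simp: bipartite_graph_def)
  define \<phi> where "\<phi> = (\<lambda>i::nat. if i = 0 then u else if i = 1 then x else if i = 2 then u' else y)"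
  have "inj_on \<phi> (verts C4)"
    using AB B u \<open>x \<noteq> y\<close> by (auto simp: inj_on_def \<phi>_def C4_def)
  moreover have "\<phi> ` verts C4 \<subseteq> verts G"
    using AB B u by (auto simp: \<phi>_def C4_def)
  moreover have "\<forall>e\<in>edges C4. \<phi> ` e \<in> edges G"
    using x by (auto simp: \<phi>_def C4_def nbhd_def insert_commute)
  ultimately show False using C4 unfolding contains_copy_def embedding_def by blast
qed

lemma vertex_degree_bipartite:
  assumes "bipartite_graph A B G"
  shows "u \<in> A \<Longrightarrow> vertex_degree G u = card (nbhd G u)"
    and "v \<in> B \<Longrightarrow> vertex_degree G v = card {u \<in> A. v \<in> nbhd G u}"
proof -
  have e: "\<exists>x\<in>A. \<exists>y\<in>B. e = {x, y}" if "e \<in> edges G" for e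
    using assms that unfolding bipartite_graph_def by blast
  have disj: "A \<inter> B = {}" using assms unfolding bipartite_graph_def by blast
  show "vertex_degree G u = card (nbhd G u)" if "u \<in> A"
  proof -
    have "{e \<in> edges G. u \<in> e} = (\<lambda>v. {u, v}) ` nbhd G u"
      using e disj that unfolding nbhd_def by fastforce
    moreover have "inj_on (\<lambda>v. {u, v}) (nbhd G u)"
      by (auto simp: inj_on_def doubleton_eq_iff)
    ultimately show ?thesis unfolding vertex_degree_def by (simp add: card_image)
  qed
  show "vertex_degree G v = card {u \<in> A. v \<in> nbhd G u}" if "v \<in> B"
  proof -
    have "{e \<in> edges G. v \<in> e} = (\<lambda>u. {u, v}) ` {u \<in> A. v \<in> nbhd G u}"
      using e disj that unfolding nbhd_def by fastforce
    moreover have "inj_on (\<lambda>u. {u, v}) {u \<in> A. v \<in> nbhd G u}"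
      by (auto simp: inj_on_def doubleton_eq_iff)
    ultimately show ?thesis unfolding vertex_degree_def by (simp add: card_image)
  qed
qed

text \<open>A copy of \<^term>\<open>F\<close> in the split graph falls into the pieces that lie in the different
  neighbourhoods.  Each piece is bipartite, and two pieces share at most one vertex since there is
  no 4-cycle.  So the pieces form a member of \<^term>\<open>bipartite_decomps F\<close>, and its incidence graph
  \<^term>\<open>J_graph F Hs\<close> embeds in \<^term>\<open>G\<close>.\<close>

lemma split_graph_F_free:
  fixes G :: "'v ugraph" and F :: "'a ugraph"
  assumes F: "simple_graph F" and G: "bipartite_graph A B G" and L: "L_free F A B G"
    and W: "verts H \<subseteq> B" "edges H \<subseteq> split_edges G A f"
    and f: "\<And>u. u \<in> A \<Longrightarrow> f u \<subseteq> nbhd G u"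
  shows "\<not> contains_copy H F"
proof
  assume "contains_copy H F"
  then obtain \<phi> where inj: "inj_on \<phi> (verts F)" and im: "\<phi> ` verts F \<subseteq> verts H"
    and hom: "\<And>e. e \<in> edges F \<Longrightarrow> \<phi> ` e \<in> edges H"
    unfolding contains_copy_def embedding_def by blast
  have C4: "\<not> contains_copy G C4" using L by (simp add: L_free_def)
  have finF: "finite (verts F)" "finite (edges F)"
    and eF: "\<And>e. e \<in> edges F \<Longrightarrow> e \<in> [verts F]\<^bsup>2\<^esup>"
    using F finite_subset[OF _ finite_imp_finite_nsets] unfolding simple_graph_def by auto
  have eV: "e \<subseteq> verts F" if "e \<in> edges F" for e
    using eF[OF that] by (auto simp: nsets_def)
  have ex: "\<exists>u. u \<in> A \<and> (\<exists>x y. e = {x, y} \<and> \<phi> x \<in> f u \<and> \<phi> y \<in> nbhd G u - f u)"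
    if e: "e \<in> edges F" for e
  proof -
    obtain x y where xy: "e = {x, y}" using eF[OF e] by (rule nsets2_E)
    have "{\<phi> x, \<phi> y} \<in> split_edges G A f" using hom[OF e] W(2) xy by auto
    then obtain u where u: "u \<in> A"
      "\<phi> x \<in> f u \<and> \<phi> y \<in> nbhd G u - f u \<or> \<phi> y \<in> f u \<and> \<phi> x \<in> nbhd G u - f u"
      unfolding split_edges_iff by blast
    moreover have "e = {y, x}" using xy by auto
    ultimately show ?thesis using xy by blast
  qed
  \<comment> \<open>Each edge of \<^term>\<open>F\<close> is coloured by a vertex of \<^term>\<open>A\<close> whose split produces its image; the colour classes are the pieces.\<close>
  define c where "c = (\<lambda>e. SOME u. u \<in> A \<and> (\<exists>x y. e = {x, y} \<and> \<phi> x \<in> f u \<and> \<phi> y \<in> nbhd G u - f u))"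
  have c: "c e \<in> A \<and> (\<exists>x y. e = {x, y} \<and> \<phi> x \<in> f (c e) \<and> \<phi> y \<in> nbhd G (c e) - f (c e))"
    if "e \<in> edges F" for e
    unfolding c_def by (rule someI_ex[OF ex[OF that]])
  obtain us where us: "set us = c ` edges F" "distinct us"
    using finite_distinct_list[of "c ` edges F"] finF(2) by auto
  define piece where "piece = (\<lambda>u. \<lparr>verts = \<Union>{e \<in> edges F. c e = u}, edges = {e \<in> edges F. c e = u}\<rparr>)"
  define Hs where "Hs = map piece us"
  have piece_nbhd: "\<phi> v \<in> nbhd G u" and piece_vert: "v \<in> verts F" if "v \<in> verts (piece u)" for u v
  proof -
    obtain e where e: "e \<in> edges F" "c e = u" "v \<in> e"
      using \<open>v \<in> verts (piece u)\<close> by (auto simp: piece_def)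
    then show "\<phi> v \<in> nbhd G u" using c[OF e(1)] f[of u] by auto
    show "v \<in> verts F" using eV e by blast
  qed
  have us_A: "u \<in> A" if "u \<in> set us" for u using that us c by auto
  have common: "card (verts (piece u) \<inter> verts (piece u')) \<le> 1"
    if "u \<in> set us" "u' \<in> set us" "u \<noteq> u'" for u u'
  proof -
    have "v = w" if "v \<in> verts (piece u) \<inter> verts (piece u')" "w \<in> verts (piece u) \<inter> verts (piece u')" for v w
    proof -
      have "\<phi> v = \<phi> w"
        using C4_free_linear[OF G C4 us_A us_A \<open>u \<noteq> u'\<close>] \<open>u \<in> set us\<close> \<open>u' \<in> set us\<close> that piece_nbhd by auto
      then show ?thesis using inj that piece_vert by (auto simp: inj_on_def)
    qed
    moreover have "finite (verts (piece u) \<inter> verts (piece u'))"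
      using piece_vert by (intro finite_subset[OF _ finF(1)]) auto
    ultimately show ?thesis
      by (auto simp: card_le_Suc0_iff_eq)
  qed
  have bip: "is_bipartite (piece u)" if "u \<in> set us" for u
  proof -
    let ?V = "verts (piece u)"
    have "simple_graph (piece u)"
      using finF(1) eV eF piece_vert[of _ u] finite_subset[of ?V "verts F"]
      unfolding simple_graph_def by (auto simp: piece_def nsets_def)
    moreover have "\<exists>x\<in>{v \<in> ?V. \<phi> v \<in> f u}. \<exists>y\<in>{v \<in> ?V. \<phi> v \<notin> f u}. e = {x, y}"
      if "e \<in> edges (piece u)" for e
    proof -
      have e: "e \<in> edges F" "c e = u" using that by (auto simp: piece_def)
      then obtain x y where xy: "e = {x, y}" "\<phi> x \<in> f u" "\<phi> y \<notin> f u" using c[OF e(1)] by auto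
      moreover have "e \<subseteq> ?V" using e by (auto simp: piece_def)
      ultimately show ?thesis by blast
    qed
    ultimately have "bipartite_graph {v \<in> ?V. \<phi> v \<in> f u} {v \<in> ?V. \<phi> v \<notin> f u} (piece u)"
      unfolding bipartite_graph_def by auto
    then show ?thesis unfolding is_bipartite_def by blast
  qed
  have "Hs \<in> bipartite_decomps F"
  proof -
    have "subgraph H' F \<and> is_bipartite H' \<and> edges H' \<noteq> {}" if "H' \<in> set Hs" for H'
    proof -
      obtain u where u: "u \<in> set us" "H' = piece u" using \<open>H' \<in> set Hs\<close> by (auto simp: Hs_def)
      have "simple_graph H'"
        using bip[OF u(1)] u(2) unfolding is_bipartite_def bipartite_graph_def by auto
      moreover have "verts H' \<subseteq> verts F" "edges H' \<subseteq> edges F" "edges H' \<noteq> {}"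
        using u us piece_vert by (auto simp: piece_def)
      ultimately show ?thesis using bip u by (auto simp: subgraph_def)
    qed
    moreover have "(\<Union>H\<in>set Hs. edges H) = edges F"
      using us by (auto simp: Hs_def piece_def)
    moreover have "edges (Hs ! i) \<inter> edges (Hs ! j) = {} \<and> card (verts (Hs ! i) \<inter> verts (Hs ! j)) \<le> 1"
      if "i < j \<and> j < length Hs" for i j
    proof -
      have "us ! i \<noteq> us ! j" "us ! i \<in> set us" "us ! j \<in> set us"
        using that us(2) by (auto simp: Hs_def nth_eq_iff_index_eq)
      then show ?thesis using that common by (auto simp: Hs_def piece_def)
    qed
    ultimately show ?thesis unfolding bipartite_decomps_def by blast
  qed
  moreover define \<psi> where "\<psi> = case_sum ((!) us) \<phi>"
  have AB: "A \<inter> B = {}" "verts G = A \<union> B" using G by (auto simp: bipartite_graph_def)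
  have imA: "\<psi> ` Inl ` {..<length Hs} \<subseteq> A"
    using us_A by (auto simp: \<psi>_def Hs_def)
  have imB: "\<psi> ` Inr ` verts F \<subseteq> B"
    using im W(1) unfolding \<psi>_def by fastforce
  have "embedding \<psi> (J_graph F Hs) G"
    unfolding embedding_def
  proof (intro conjI ballI)
    have "inj_on \<psi> (Inl ` {..<length Hs})"
      using us(2) by (auto simp: inj_on_def \<psi>_def Hs_def nth_eq_iff_index_eq)
    moreover have "inj_on \<psi> (Inr ` verts F)"
      using inj by (auto simp: inj_on_def \<psi>_def)
    ultimately show "inj_on \<psi> (verts (J_graph F Hs))"
      using imA imB AB(1) by (auto simp: J_graph_def inj_on_Un)
    show "\<psi> ` verts (J_graph F Hs) \<subseteq> verts G"
      unfolding J_graph_def AB(2) ugraph.simps image_Un using imA imB by blast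
    fix e assume "e \<in> edges (J_graph F Hs)"
    then obtain i v where e: "e = {Inl i, Inr v}" "i < length Hs" "v \<in> verts (Hs ! i)"
      by (auto simp: J_graph_def)
    then have "\<phi> v \<in> nbhd G (us ! i)" using piece_nbhd by (auto simp: Hs_def)
    then show "\<psi> ` e \<in> edges G" using e by (simp add: \<psi>_def nbhd_def)
  qed
  ultimately show False using L imA imB unfolding L_free_def by blast
qed

lemma mnab_double_count:
  assumes "mnab_graph m n a b A B G"
  shows "m * b = n * a"
proof -
  have G: "bipartite_graph A B G" and fin: "finite A" "finite B"
    using assms by (auto simp: mnab_graph_def bipartite_graph_def simple_graph_def)
  have "m * b = (\<Sum>u\<in>A. card {v \<in> B. v \<in> nbhd G u})"
  proof -
    have "card {v \<in> B. v \<in> nbhd G u} = b" if "u \<in> A" for u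
    proof -
      have "{v \<in> B. v \<in> nbhd G u} = nbhd G u" using bipartite_nbhd[OF G that] by blast
      then show ?thesis
        using assms that vertex_degree_bipartite(1)[OF G that] by (simp add: mnab_graph_def)
    qed
    then show ?thesis using assms by (simp add: mnab_graph_def)
  qed
  also have "\<dots> = (\<Sum>v\<in>B. card {u \<in> A. v \<in> nbhd G u})"
    using fin by (rule sum_card_incidence)
  also have "\<dots> = n * a"
    using assms vertex_degree_bipartite(2)[OF G] by (simp add: mnab_graph_def)
  finally show ?thesis .
qed

text \<open>The neighbourhoods through a fixed vertex of \<^term>\<open>B\<close> are disjoint apart from that vertex.\<close>

lemma mnab_C4_free_bound:
  assumes G: "mnab_graph m n a b A B G" and C4: "\<not> contains_copy G C4" and "n > 0"
  shows "a * (b - 1) \<le> n"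
proof -
  have bip: "bipartite_graph A B G" and fin: "finite A" "finite B" and B: "card B = n"
    using G by (auto simp: mnab_graph_def bipartite_graph_def simple_graph_def)
  obtain v where v: "v \<in> B" using B assms(3) by (cases "B = {}") auto
  let ?U = "{u \<in> A. v \<in> nbhd G u}"
  have cU: "card ?U = a"
    using G v vertex_degree_bipartite(2)[OF bip v] by (simp add: mnab_graph_def)
  have finN: "finite (nbhd G u)" if "u \<in> A" for u
    using bipartite_nbhd[OF bip that] fin finite_subset by blast
  have c: "card (nbhd G u - {v}) = b - 1" if "u \<in> ?U" for u
    using that G vertex_degree_bipartite(1)[OF bip, of u] finN by (auto simp: mnab_graph_def)
  have "a * (b - 1) = (\<Sum>u\<in>?U. card (nbhd G u - {v}))"
    using cU c by simp
  also have "\<dots> = card (\<Union>u\<in>?U. nbhd G u - {v})"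
  proof (rule card_UN_disjoint[symmetric])
    show "\<forall>u\<in>?U. \<forall>u'\<in>?U. u \<noteq> u' \<longrightarrow> (nbhd G u - {v}) \<inter> (nbhd G u' - {v}) = {}"
      using C4_free_linear[OF bip C4] by blast
  qed (use fin finN in auto)
  also have "\<dots> \<le> card B"
    using bipartite_nbhd[OF bip] fin by (intro card_mono) auto
  finally show ?thesis using B by simp
qed

text \<open>Since \<open>m b = n a\<close>, the threshold \<open>64 m \<le> a |S|\<close> and the degree \<open>a\<^sup>2 |S| / (64 m)\<close> become
  \<open>64 n / b \<le> |S|\<close> and \<open>a b |S| / (64 n)\<close>.\<close>

lemma exists_split_with_large_degrees:
  fixes G :: "'v ugraph"
  assumes G: "mnab_graph m n a b A B G" and C4: "\<not> contains_copy G C4"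
    and "n \<ge> 2" "a > 0" "b > 0" and a: "real a \<ge> 2 ^ 12 * log 2 (real n)"
  shows "\<exists>f. (\<forall>u\<in>A. f u \<subseteq> nbhd G u) \<and> (\<forall>S\<subseteq>B. 64 * real n / real b < real (card S) \<longrightarrow>
    (\<exists>v\<in>S. real a * real b / (64 * real n) * real (card S) \<le> real (card {w \<in> S. {v, w} \<in> split_edges G A f})))"
proof -
  have bip: "bipartite_graph A B G" and fin: "finite A" "finite B" and card: "card A = m" "card B = n"
    using G by (auto simp: mnab_graph_def bipartite_graph_def simple_graph_def)
  note mb = mnab_double_count[OF G]
  have deg: "card {u \<in> A. v \<in> nbhd G u} = a" if "v \<in> B" for v
    using G that vertex_degree_bipartite(2)[OF bip that] by (simp add: mnab_graph_def)
  obtain f where f: "\<And>u. u \<in> A \<Longrightarrow> f u \<subseteq> nbhd G u"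
    and bal: "\<And>S. S \<subseteq> B \<Longrightarrow> S \<noteq> {} \<Longrightarrow> 64 * card A \<le> a * card S \<Longrightarrow>
      2 * (\<Sum>u | u \<in> A \<and> unbalanced (nbhd G u \<inter> S) (f u). card (nbhd G u \<inter> S)) < a * card S"
    using exists_balanced_bipartitions[OF fin bipartite_nbhd[OF bip] deg] assms(3) a card by auto
  have "\<exists>v\<in>S. real a * real b / (64 * real n) * real (card S) \<le> real (card {w \<in> S. {v, w} \<in> split_edges G A f})"
    if S: "S \<subseteq> B" "64 * real n / real b < real (card S)" for S
  proof -
    have finS: "finite S" using S(1) fin finite_subset by blast
    have "0 \<le> 64 * real n / real b" by simp
    then have "0 < card S" using S(2) by linarith
    then have "S \<noteq> {}" by auto
    have "real (64 * n) < real (card S * b)" using S(2) assms(5) by (simp add: divide_simps)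
    then have "64 * n < card S * b" by (simp only: of_nat_less_iff)
    then have "64 * n * a \<le> card S * b * a" by (intro mult_right_mono) auto
    moreover have "64 * n * a = b * (64 * m)" using mb by (simp add: mult_ac)
    ultimately have "b * (64 * m) \<le> b * (a * card S)" by (simp only: mult_ac)
    then have "64 * card A \<le> a * card S" using assms(5) card by simp
    note bal = bal[OF S(1) \<open>S \<noteq> {}\<close> this]
    have lin: "u = u'" if "u \<in> A" "u' \<in> A" "{x, y} \<subseteq> nbhd G u" "{x, y} \<subseteq> nbhd G u'" "x \<noteq> y" for u u' x y
      using C4_free_linear[OF bip C4] that by blast
    have "\<exists>v\<in>S. a\<^sup>2 * card S \<le> 64 * card A * card {w \<in> S. \<exists>u\<in>A. v \<in> f u \<and> w \<in> nbhd G u - f u}"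
    proof (rule exists_vertex_of_large_degree[OF fin(1) finS \<open>S \<noteq> {}\<close> _ _ _ bal])
      show "card {u \<in> A. v \<in> nbhd G u} = a" if "v \<in> S" for v
        using that S(1) by (intro deg) auto
      show "f u \<subseteq> nbhd G u" if "u \<in> A" for u
        using that by (rule f)
    qed (rule lin)
    then obtain v where v: "v \<in> S"
      "a\<^sup>2 * card S \<le> 64 * card A * card {w \<in> S. \<exists>u\<in>A. v \<in> f u \<and> w \<in> nbhd G u - f u}"
      by (rule bexE)
    let ?d = "card {w \<in> S. {v, w} \<in> split_edges G A f}"
    have "card {w \<in> S. \<exists>u\<in>A. v \<in> f u \<and> w \<in> nbhd G u - f u} \<le> ?d"
      using finS unfolding split_edges_iff by (intro card_mono) auto
    then have "64 * card A * card {w \<in> S. \<exists>u\<in>A. v \<in> f u \<and> w \<in> nbhd G u - f u} \<le> 64 * card A * ?d"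
      by (rule mult_left_mono) simp
    from order_trans[OF v(2) this] have "a\<^sup>2 * card S \<le> 64 * m * ?d"
      unfolding card(1) .
    then have "a\<^sup>2 * card S * b \<le> 64 * m * ?d * b" by (rule mult_right_mono) simp
    also have "64 * m * ?d * b = 64 * (n * a) * ?d" unfolding mb[symmetric] by (simp add: mult_ac)
    finally have "a * (a * b * card S) \<le> a * (64 * n * ?d)"
      by (simp add: power2_eq_square mult_ac)
    then have "a * b * card S \<le> 64 * n * ?d" using assms(4) by simp
    then have "real (a * b * card S) \<le> real (64 * n * ?d)" by (rule of_nat_mono)
    then have "real a * real b / (64 * real n) * real (card S) \<le> real ?d"
      using assms(3) by (simp add: divide_simps mult_ac)
    then show ?thesis using v(1) by blast
  qed
  then show ?thesis using f by blast
qed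


section \<open>Counting independent sets\<close>

text \<open>A weighted form of the Kleitman-Winston bound.  If every set of more than \<^term>\<open>R\<close> vertices
  has a vertex joined to a proportion \<^term>\<open>\<beta>\<close> of it, then branching on whether this vertex
  belongs to the independent set removes either one vertex or a proportion \<^term>\<open>\<beta>\<close> of all
  vertices.  The second case can occur at most \<^term>\<open>q\<close> times before at most \<^term>\<open>R\<close> vertices
  remain, and on these the trivial bound \<open>(1 + x)\<^bsup>R\<^esup>\<close> suffices.  Weighting a set of size
  \<open>k\<close> by \<open>x\<^bsup>k\<^esup>\<close> avoids binomial coefficients.\<close>

lemma weighted_indep_bound:
  fixes E :: "'v set set" and x \<beta> R :: real
  assumes "finite B" "0 \<le> x" "x \<le> 1" "0 \<le> R"
    and deg: "\<And>S. S \<subseteq> B \<Longrightarrow> R < card S \<Longrightarrow> \<exists>v\<in>S. \<beta> * card S \<le> card {w \<in> S. {v, w} \<in> E}"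
    and "S \<subseteq> B" "(1 - \<beta>) ^ q * card S \<le> R" "\<beta> \<le> 1"
  shows "(\<Sum>I | I \<subseteq> S \<and> indep I E. x ^ card I) \<le> (real (card S) + 1) ^ q * exp (x * R)"
  using assms(6,7)
proof (induction "card S" arbitrary: S q rule: less_induct)
  case less
  have finS: "finite S" using less.prems assms(1) finite_subset by blast
  have fin: "finite {I. I \<subseteq> V \<and> indep I E}" if "V \<subseteq> S" for V
    using finS that by - (rule finite_subset[of _ "Pow S"], auto)
  show ?case
  proof (cases "real (card S) \<le> R")
    case True
    have "(\<Sum>I | I \<subseteq> S \<and> indep I E. x ^ card I) \<le> (\<Sum>I\<in>Pow S. x ^ card I)"
      using finS assms(2) by (intro sum_mono2) auto
    also have "\<dots> = (1 + x) ^ card S"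
      using sum_prod_Pow[OF finS, of "\<lambda>_. x"] by simp
    also have "\<dots> \<le> exp x ^ card S"
      using assms(2) by (intro power_mono) (auto simp: exp_ge_add_one_self)
    also have "\<dots> = exp (x * card S)"
      by (metis exp_of_nat_mult mult.commute)
    also have "\<dots> \<le> 1 * exp (x * R)"
      using True assms(2) by (auto intro: mult_left_mono)
    also have "\<dots> \<le> (real (card S) + 1) ^ q * exp (x * R)"
      by (intro mult_right_mono one_le_power) auto
    finally show ?thesis .
  next
    case False
    then obtain v where v: "v \<in> S" "\<beta> * card S \<le> card {w \<in> S. {v, w} \<in> E}"
      using deg[OF less.prems(1)] by auto
    obtain p where q: "q = Suc p"
      using False less.prems(2) by (cases q) auto
    let ?s = "real (card S)"
    define S1 where "S1 = S - {v}"
    define S2 where "S2 = S - {v} - {w. {v, w} \<in> E}"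
    have sub: "S1 \<subseteq> S" "S2 \<subseteq> S" "S1 \<subseteq> B" "S2 \<subseteq> B"
      using less.prems(1) by (auto simp: S1_def S2_def)
    have pos: "card S > 0" using v finS card_gt_0_iff by blast
    have c1: "card S1 = card S - 1" using v finS by (simp add: S1_def)
    have c2: "card S2 \<le> card S1"
      unfolding S1_def S2_def using finS by (intro card_mono) auto
    have "card S2 \<le> card (S - {w \<in> S. {v, w} \<in> E})"
      unfolding S2_def using finS by (intro card_mono) auto
    also have "\<dots> = card S - card {w \<in> S. {v, w} \<in> E}"
      using finS by (subst card_Diff_subset) auto
    finally have "real (card S2) \<le> ?s - card {w \<in> S. {v, w} \<in> E}"
      using card_mono[OF finS, of "{w \<in> S. {v, w} \<in> E}"] by auto
    then have s2: "real (card S2) \<le> (1 - \<beta>) * ?s"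
      using v by (simp add: algebra_simps)
    have "(1 - \<beta>) ^ p * card S2 \<le> (1 - \<beta>) ^ p * ((1 - \<beta>) * ?s)"
      using s2 assms(8) by (intro mult_left_mono) auto
    also have "\<dots> \<le> R" using less.prems(2) q by (simp add: algebra_simps)
    finally have h2: "(1 - \<beta>) ^ p * card S2 \<le> R" .
    have "(1 - \<beta>) ^ q * card S1 \<le> (1 - \<beta>) ^ q * card S"
      using c1 assms(8) by (intro mult_left_mono) auto
    then have h1: "(1 - \<beta>) ^ q * card S1 \<le> R" using less.prems(2) by linarith
    let ?Z = "\<lambda>V. \<Sum>I | I \<subseteq> V \<and> indep I E. x ^ card I"
    have IH1: "?Z S1 \<le> ?s ^ q * exp (x * R)"
      using less.hyps[OF _ sub(3) h1] c1 pos by (simp add: of_nat_diff)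
    have "?Z S2 \<le> (real (card S2) + 1) ^ p * exp (x * R)"
      using less.hyps[OF _ sub(4) h2] c1 c2 pos by simp
    also have "\<dots> \<le> ?s ^ p * exp (x * R)"
      using c1 c2 pos by (intro mult_right_mono power_mono) auto
    finally have IH2: "?Z S2 \<le> ?s ^ p * exp (x * R)" .
    have Z2: "?Z S2 \<ge> 0" using assms(2) by (intro sum_nonneg) auto
    have "{I. I \<subseteq> S \<and> indep I E} \<subseteq>
        {I. I \<subseteq> S1 \<and> indep I E} \<union> insert v ` {I. I \<subseteq> S2 \<and> indep I E}"
    proof
      fix I assume I: "I \<in> {I. I \<subseteq> S \<and> indep I E}"
      show "I \<in> {I. I \<subseteq> S1 \<and> indep I E} \<union> insert v ` {I. I \<subseteq> S2 \<and> indep I E}"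
      proof (cases "v \<in> I")
        case True
        then have "I = insert v (I - {v})" "I - {v} \<subseteq> S2" "indep (I - {v}) E"
          using I by (auto simp: S2_def indep_def)
        then show ?thesis by blast
      next
        case False
        then show ?thesis using I by (auto simp: S1_def)
      qed
    qed
    then have "?Z S \<le> (\<Sum>I\<in>{I. I \<subseteq> S1 \<and> indep I E} \<union> insert v ` {I. I \<subseteq> S2 \<and> indep I E}. x ^ card I)"
      using fin[OF sub(1)] fin[OF sub(2)] assms(2) by (intro sum_mono2) auto
    also have "\<dots> = ?Z S1 + (\<Sum>I\<in>insert v ` {I. I \<subseteq> S2 \<and> indep I E}. x ^ card I)"
      using fin[OF sub(1)] fin[OF sub(2)] by (intro sum.union_disjoint) (auto simp: S1_def)
    also have "(\<Sum>I\<in>insert v ` {I. I \<subseteq> S2 \<and> indep I E}. x ^ card I)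
        = (\<Sum>I | I \<subseteq> S2 \<and> indep I E. x * x ^ card I)"
    proof (subst sum.reindex)
      show "inj_on (insert v) {I. I \<subseteq> S2 \<and> indep I E}"
        by (auto simp: inj_on_def S2_def)
      have "card (insert v I) = Suc (card I)" if "I \<subseteq> S2" for I
        using that finS sub finite_subset[of I S] by (subst card_insert_disjoint) (auto simp: S2_def)
      then show "(\<Sum>I | I \<subseteq> S2 \<and> indep I E. ((\<lambda>I. x ^ card I) \<circ> insert v) I)
          = (\<Sum>I | I \<subseteq> S2 \<and> indep I E. x * x ^ card I)"
        by (intro sum.cong) auto
    qed
    also have "\<dots> = x * ?Z S2" by (simp add: sum_distrib_left)
    also have "\<dots> \<le> ?Z S2" using assms(2,3) Z2 by (simp add: mult_left_le_one_le)
    finally have "?Z S \<le> ?s ^ q * exp (x * R) + ?s ^ p * exp (x * R)"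
      using IH1 IH2 by linarith
    also have "\<dots> = ?s ^ p * (?s + 1) * exp (x * R)" by (simp add: q algebra_simps)
    also have "\<dots> \<le> (?s + 1) ^ p * (?s + 1) * exp (x * R)"
      by (intro mult_right_mono power_mono) auto
    finally show ?thesis by (simp add: q mult.commute)
  qed
qed


section \<open>Random induced subgraphs\<close>

text \<open>A uniformly random \<^term>\<open>N\<close>-subset of \<^term>\<open>B\<close> contains a given \<^term>\<open>T\<close>-set with
  probability at most \<open>(N / |B|)\<^bsup>T\<^esup>\<close>.\<close>

lemma exists_subset_avoiding:
  assumes "finite B" and I: "\<And>I. I \<in> \<I> \<Longrightarrow> I \<subseteq> B \<and> card I = T"
    and "N \<le> card B" and small: "real (card \<I>) * (real N / real (card B)) ^ T < 1"
  shows "\<exists>W\<subseteq>B. card W = N \<and> (\<forall>I\<in>\<I>. \<not> I \<subseteq> W)"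
proof (rule ccontr)
  assume "\<not> ?thesis"
  then have no: "\<exists>I\<in>\<I>. I \<subseteq> W" if "W \<subseteq> B" "card W = N" for W
    using that by blast
  let ?n = "card B"
  have finI: "finite \<I>"
    using I assms(1) by - (rule finite_subset[of \<I> "Pow B"], auto)
  have sup: "real (card {W. I \<subseteq> W \<and> W \<subseteq> B \<and> card W = N}) \<le> (real N / real ?n) ^ T * real (?n choose N)"
    if "I \<in> \<I>" for I
  proof (cases "T \<le> N")
    case False
    have "T \<le> card W" if "I \<subseteq> W" "W \<subseteq> B" for W
      using card_mono[OF finite_subset[OF that(2) assms(1)] that(1)] I[OF \<open>I \<in> \<I>\<close>] by simp
    then have "{W. I \<subseteq> W \<and> W \<subseteq> B \<and> card W = N} = {}"
      using False by auto
    then have "card {W. I \<subseteq> W \<and> W \<subseteq> B \<and> card W = N} = 0"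
      by (simp only: card.empty)
    then show ?thesis by simp
  next
    case True
    have finIB: "finite I" using I[OF that] assms(1) finite_subset by blast
    have "card {W. I \<subseteq> W \<and> W \<subseteq> B \<and> card W = N} \<le> card {V. V \<subseteq> B - I \<and> card V = N - T}"
    proof (rule card_inj_on_le[of "\<lambda>W. W - I"])
      show "inj_on (\<lambda>W. W - I) {W. I \<subseteq> W \<and> W \<subseteq> B \<and> card W = N}"
        by (rule inj_onI) blast
      show "(\<lambda>W. W - I) ` {W. I \<subseteq> W \<and> W \<subseteq> B \<and> card W = N} \<subseteq> {V. V \<subseteq> B - I \<and> card V = N - T}"
        using I[OF that] finIB by (auto simp: card_Diff_subset)
      show "finite {V. V \<subseteq> B - I \<and> card V = N - T}"
        using assms(1) by - (rule finite_subset[of _ "Pow B"], auto)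
    qed
    also have "\<dots> = (?n - T) choose (N - T)"
      using assms(1) I[OF that] finIB by (subst n_subsets) (auto simp: card_Diff_subset)
    finally have 1: "real (card {W. I \<subseteq> W \<and> W \<subseteq> B \<and> card W = N}) \<le> real ((?n - T) choose (N - T))"
      by simp
    have "real ((n - T) choose (N - T)) \<le> (real N / real n) ^ T * real (n choose N)"
      if "N \<le> n" "T \<le> N" for n
      using that(2)
    proof (induction T)
      case 0 then show ?case by simp
    next
      case (Suc T)
      then have le: "T < N" "T < n" using that by auto
      \<comment> \<open>Passing from \<^term>\<open>T\<close> to \<^term>\<open>Suc T\<close> multiplies the left side by \<open>(N - T) / (n - T) \<le> N / n\<close>.\<close>
      have e: "(N - T) * ((n - T) choose (N - T)) = (n - T) * ((n - Suc T) choose (N - Suc T))"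
        using binomial_absorption[of "N - Suc T" "n - T"] le by (simp add: Suc_diff_Suc)
      have r: "real (N - T) / real (n - T) \<le> real N / real n"
      proof -
        have "real N * real T \<le> real n * real T"
          using that by (intro mult_right_mono) auto
        then show ?thesis
          using le by (simp add: divide_simps of_nat_diff algebra_simps)
      qed
      have "real ((n - Suc T) choose (N - Suc T)) = real (N - T) / real (n - T) * real ((n - T) choose (N - T))"
        using arg_cong[OF e, of real] le by (simp add: field_simps)
      also have "\<dots> \<le> real N / real n * ((real N / real n) ^ T * real (n choose N))"
        using Suc r le by (intro mult_mono) auto
      finally show ?case by simp
    qed
    from this[OF \<open>N \<le> ?n\<close> True] 1 show ?thesis by linarith
  qed
  have "real (?n choose N) = real (card {W. W \<subseteq> B \<and> card W = N})"
    using assms by (simp add: n_subsets)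
  also have "\<dots> \<le> real (card (\<Union>I\<in>\<I>. {W. I \<subseteq> W \<and> W \<subseteq> B \<and> card W = N}))"
  proof (intro of_nat_mono card_mono)
    have "(\<Union>I\<in>\<I>. {W. I \<subseteq> W \<and> W \<subseteq> B \<and> card W = N}) \<subseteq> Pow B"
      by blast
    then show "finite (\<Union>I\<in>\<I>. {W. I \<subseteq> W \<and> W \<subseteq> B \<and> card W = N})"
      using assms(1) finite_subset by blast
    show "{W. W \<subseteq> B \<and> card W = N} \<subseteq> (\<Union>I\<in>\<I>. {W. I \<subseteq> W \<and> W \<subseteq> B \<and> card W = N})"
      using no by blast
  qed
  also have "\<dots> \<le> real (\<Sum>I\<in>\<I>. card {W. I \<subseteq> W \<and> W \<subseteq> B \<and> card W = N})"
    using finI by (intro of_nat_mono card_UN_le)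
  also have "\<dots> \<le> (\<Sum>I\<in>\<I>. (real N / real ?n) ^ T * real (?n choose N))"
    unfolding of_nat_sum by (intro sum_mono sup)
  also have "\<dots> = (real (card \<I>) * (real N / real ?n) ^ T) * real (?n choose N)"
    by simp
  also have "\<dots> < 1 * real (?n choose N)"
    using small assms by (intro mult_strict_right_mono) auto
  finally show False by simp
qed


section \<open>The lower bound\<close>

text \<open>The estimates needed for the branching bound with threshold \<open>R = 64 n / b\<close>, degree proportion
  \<open>\<beta> = a b / (64 n)\<close> and weight \<open>x = t / R = 4 L\<^sup>2 / a\<close>.  About \<open>(ln n) / \<beta>\<close> steps reduce
  \<open>n\<close> vertices to \<open>R\<close>, and \<open>t\<close> is so large that the branching factor for that many
  steps is at most \<open>2\<^bsup>t\<^esup>\<close>.\<close>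

lemma container_parameters:
  fixes a b n :: nat and t L :: real
  assumes L: "L = log 2 (real n)" and "n \<ge> 2" and a: "real a \<ge> 2 ^ 12 * L ^ 3" and "a \<le> b"
    and ab: "a * (b - 1) \<le> n" and t: "t = 2 ^ 8 * real n * L ^ 2 / (real a * real b)"
  shows "1 \<le> L" and "1 \<le> t" and "4 * L ^ 2 / real a \<le> 1" and "real a * real b / (64 * real n) \<le> 1"
    and "\<exists>q. (1 - real a * real b / (64 * real n)) ^ q * real n \<le> 64 * real n / real b \<and>
      (real n + 1) ^ q * exp t \<le> 8 powr t"
proof -
  show L1: "1 \<le> L" using assms(2) unfolding L by (subst le_log_iff) auto
  have L12: "L \<le> L ^ 2" "L ^ 2 \<le> L ^ 3"
    using L1 power_increasing[of 1 2 L] power_increasing[of 2 3 L] by auto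
  have aL: "4096 * L ^ 2 \<le> real a" "4096 \<le> real a" using a L12 L1 by auto
  have b: "4096 \<le> real b" using aL assms(4) by linarith
  show "4 * L ^ 2 / real a \<le> 1" using aL L1 by (simp add: divide_simps)
  define D where "D = real a * real b"
  have Dpos: "D > 0" using aL b by (simp add: D_def)
  have ab': "real a * (real b - 1) \<le> real n"
    using of_nat_mono[OF ab, where ?'a = real] b by (simp add: of_nat_diff)
  have "real a * real b \<le> real a * (2 * (real b - 1))"
    using b by (intro mult_left_mono) auto
  then have D2: "D \<le> 2 * real n" using ab' by (simp add: D_def algebra_simps)
  have "2 * (real b - 1) \<le> real a * (real b - 1)"
    using aL b by (intro mult_right_mono) auto
  from order_trans[OF this ab'] have bn: "real b \<le> real n" using b by simp
  have n0: "real n > 0" using assms(2) by simp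
  have t': "t = 256 * real n * L ^ 2 / D" by (simp add: t D_def)
  have "128 * L ^ 2 * D \<le> 128 * L ^ 2 * (2 * real n)"
    using D2 by (intro mult_left_mono) auto
  then have tL: "128 * L ^ 2 \<le> t"
    unfolding t' using Dpos by (simp add: divide_simps mult_ac)
  then show "1 \<le> t" using L12 L1 by linarith
  define \<beta> where "\<beta> = D / (64 * real n)"
  have \<beta>: "\<beta> > 0" "\<beta> \<le> 1" using D2 Dpos n0 by (auto simp: \<beta>_def divide_simps)
  then show "real a * real b / (64 * real n) \<le> 1" by (simp add: \<beta>_def D_def)
  define q where "q = nat \<lceil>ln (real n) / \<beta>\<rceil>"
  have lnn: "ln (real n) \<ge> 0" using assms(2) by simp
  have q_ge: "ln (real n) / \<beta> \<le> real q" unfolding q_def by linarith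
  have q_le: "real q \<le> ln (real n) / \<beta> + 1"
    unfolding q_def using lnn \<beta> by (simp add: of_nat_nat)
  have "(1 - \<beta>) ^ q \<le> exp (- \<beta>) ^ q"
    using \<beta> exp_ge_add_one_self[of "- \<beta>"] by (intro power_mono) auto
  also have "\<dots> = exp (- (\<beta> * q))" by (simp flip: exp_of_nat_mult add: mult.commute)
  also have "\<dots> \<le> exp (- ln (real n))"
    using q_ge \<beta> by (simp add: divide_simps mult.commute)
  also have "\<dots> = 1 / real n" using n0 by (simp add: exp_minus divide_inverse)
  finally have "(1 - \<beta>) ^ q * real n \<le> 1" using n0 by (simp add: divide_simps)
  also have "1 \<le> 64 * real n / real b" using bn b by (simp add: divide_simps)
  finally have small: "(1 - \<beta>) ^ q * real n \<le> 64 * real n / real b" .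
  have "ln (real n) \<le> L"
  proof -
    have "ln (real n) = L * ln 2" unfolding L by (simp add: log_def)
    also have "\<dots> \<le> L * 1" using L1 ln_2_less_1 by (intro mult_left_mono) auto
    finally show ?thesis by simp
  qed
  then have "ln (real n) / \<beta> \<le> L / \<beta>" using \<beta> by (simp add: divide_right_mono)
  then have "2 * L * q \<le> 2 * L * (L / \<beta> + 1)" using q_le L1 by (intro mult_left_mono) auto
  also have "\<dots> = t / 2 + 2 * L"
    using Dpos n0 by (simp add: t' \<beta>_def divide_simps power2_eq_square algebra_simps)
  also have "\<dots> \<le> t" using tL L12 L1 by linarith
  finally have qt: "2 * L * q \<le> t" .
  have "real n + 1 \<le> real n ^ 2"
  proof -
    have "real n + 1 \<le> real n * 2" using assms(2) by simp
    also have "\<dots> \<le> real n * real n" using assms(2) by (intro mult_left_mono) auto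
    finally show ?thesis by (simp add: power2_eq_square)
  qed
  then have "(real n + 1) ^ q \<le> (real n ^ 2) ^ q" by (intro power_mono) auto
  also have "(real n ^ 2) ^ q = 2 powr (2 * L * q)"
  proof -
    have "real n = 2 powr L" using n0 by (simp add: L)
    then show ?thesis by (simp add: powr_power mult_ac)
  qed
  also have "\<dots> \<le> 2 powr t" using qt by (intro powr_mono) auto
  finally have 1: "(real n + 1) ^ q \<le> 2 powr t" .
  have "exp t = exp 1 powr t" by (simp add: powr_def)
  also have "\<dots> \<le> 4 powr t"
    using exp_le \<open>1 \<le> t\<close> by (intro powr_mono2) auto
  finally have "(real n + 1) ^ q * exp t \<le> 2 powr t * 4 powr t"
    using 1 by (intro mult_mono) auto
  also have "\<dots> = 8 powr t" by (simp flip: powr_mult)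
  finally have "(real n + 1) ^ q * exp t \<le> 8 powr t" .
  then show "\<exists>q. (1 - real a * real b / (64 * real n)) ^ q * real n \<le> 64 * real n / real b \<and>
      (real n + 1) ^ q * exp t \<le> 8 powr t"
    using small unfolding \<beta>_def D_def by blast
qed

text \<open>The lower bound without the logarithm in the denominator.\<close>

lemma ramsey_lower_bound:
  fixes F :: "'a ugraph" and G :: "nat ugraph" and t :: real
  assumes F: "simple_graph F" and G: "mnab_graph m n a b A B G" and Lf: "L_free F A B G"
    and "n \<ge> 2" "a > 0" "b > 0" and a: "real a \<ge> 2 ^ 12 * (log 2 (real n)) ^ 3"
    and t: "t = 2 ^ 8 * real n * (log 2 (real n)) ^ 2 / (real a * real b)"
  shows "real b * t / 1024 \<le> real (ramsey_number_real F t)"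
proof (rule ccontr)
  define L where "L = log 2 (real n)"
  define T where "T = nat \<lceil>t\<rceil>"
  define N where "N = ramsey_number F T"
  assume "\<not> ?thesis"
  then have N: "real N < real b * t / 1024" by (simp add: N_def T_def ramsey_number_real_def)
  have bip: "bipartite_graph A B G" and fin: "finite A" "finite B" and card: "card A = m" "card B = n"
    and "a \<le> b"
    using G by (auto simp: mnab_graph_def bipartite_graph_def simple_graph_def)
  have C4: "\<not> contains_copy G C4" using Lf by (simp add: L_free_def)
  have abn: "a * (b - 1) \<le> n" using mnab_C4_free_bound[OF G C4] assms(4) by simp
  note params = container_parameters[OF L_def assms(4) a[folded L_def] \<open>a \<le> b\<close> abn t[folded L_def]]
  have "L \<le> L ^ 3" using params(1) power_increasing[of 1 3 L] by auto
  then have "real a \<ge> 2 ^ 12 * log 2 (real n)" using a unfolding L_def by simp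
  then obtain f where f: "\<And>u. u \<in> A \<Longrightarrow> f u \<subseteq> nbhd G u"
    and deg: "\<And>S. S \<subseteq> B \<Longrightarrow> 64 * real n / real b < real (card S) \<Longrightarrow>
      \<exists>v\<in>S. real a * real b / (64 * real n) * real (card S) \<le> real (card {w \<in> S. {v, w} \<in> split_edges G A f})"
    using exists_split_with_large_degrees[OF G C4 assms(4-6)] by blast
  let ?E = "split_edges G A f"
  obtain q where q: "(1 - real a * real b / (64 * real n)) ^ q * real (card B) \<le> 64 * real n / real b"
    "(real n + 1) ^ q * exp t \<le> 8 powr t"
    using params(5) card by auto
  define x where "x = 4 * L ^ 2 / real a"
  have x: "0 \<le> x" "x \<le> 1" using params(3) by (auto simp: x_def)
  have xR: "x * (64 * real n / real b) = t" "x / 16 = real b * t / 1024 / real n"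
    using assms(4-6) by (simp_all add: x_def t L_def)
  define \<I> where "\<I> = {I. I \<subseteq> B \<and> indep I ?E \<and> card I = T}"
  have finI: "finite {I. I \<subseteq> B \<and> indep I ?E}"
    by (rule finite_subset[of _ "Pow B"]) (use fin in auto)
  have T: "t \<le> real T" "T \<ge> 1" unfolding T_def using params(2) by linarith+
  have "real (card \<I>) * x ^ T = (\<Sum>I\<in>\<I>. x ^ card I)"
    by (simp add: \<I>_def)
  also have "\<dots> \<le> (\<Sum>I | I \<subseteq> B \<and> indep I ?E. x ^ card I)"
    using finI x by (intro sum_mono2) (auto simp: \<I>_def)
  also have "\<dots> \<le> (real (card B) + 1) ^ q * exp (x * (64 * real n / real b))"
    by (rule weighted_indep_bound[OF fin(2) x _ deg order_refl q(1) params(4)]) auto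
  also have "\<dots> \<le> 8 powr t" using q(2) by (simp only: xR card)
  also have "\<dots> \<le> 8 powr real T" using T by (intro powr_mono) auto
  finally have count: "real (card \<I>) * x ^ T \<le> 8 ^ T" by (simp add: powr_realpow)
  have Nx: "real N / real n \<le> x / 16"
    unfolding xR(2) using N by (intro divide_right_mono) auto
  then have "real N / real n \<le> 1" using x by linarith
  then have "N \<le> card B" using assms(4) card by simp
  have "real (card \<I>) * (real N / real (card B)) ^ T \<le> real (card \<I>) * (x / 16) ^ T"
    using Nx card by (intro mult_left_mono power_mono) auto
  also have "\<dots> = real (card \<I>) * x ^ T / 16 ^ T" by (simp add: power_divide)
  also have "\<dots> \<le> 8 ^ T / 16 ^ T" using count by (intro divide_right_mono) auto
  also have "\<dots> = (1 / 2) ^ T" by (simp flip: power_divide)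
  also have "\<dots> < 1" using T by (simp add: power_less_one_iff)
  finally obtain W where W: "W \<subseteq> B" "card W = N" "\<And>I. I \<in> \<I> \<Longrightarrow> \<not> I \<subseteq> W"
    using exists_subset_avoiding[of B \<I> T N] fin \<open>N \<le> card B\<close> by (auto simp: \<I>_def)
  \<comment> \<open>This graph has exactly \<^term>\<open>N\<close> vertices, and \<^term>\<open>N\<close>, being the Ramsey number, forces an independent set of order \<^term>\<open>T\<close> in it.\<close>
  define H where "H = \<lparr>verts = W, edges = {e \<in> ?E. e \<subseteq> W}\<rparr>"
  have "simple_graph H"
    using W(1) fin(2) finite_subset by (auto simp: simple_graph_def H_def split_edges_def)
  moreover have "\<not> contains_copy H F"
    using W f by (intro split_graph_F_free[OF F bip Lf]) (auto simp: H_def)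
  moreover have "card (verts H) = N" using W by (simp add: H_def)
  moreover have "\<forall>G :: nat ugraph. simple_graph G \<and> card (verts G) = N \<and> \<not> contains_copy G F \<longrightarrow>
      (\<exists>S \<subseteq> verts G. card S = T \<and> indep S (edges G))"
    unfolding N_def ramsey_number_def by (rule LeastI_ex[OF ramsey_number_exists[OF F]])
  ultimately obtain S where S: "S \<subseteq> W" "card S = T" "indep S (edges H)"
    unfolding H_def by auto
  then have "indep S ?E" unfolding indep_def H_def by auto
  then have "S \<in> \<I>" using S W by (auto simp: \<I>_def)
  then show False using W(3) S(1) by blast
qed

theorem theorem1:
  fixes F :: "'a ugraph"
  assumes "simple_graph F"
  shows "\<exists>c :: real. c > 0 \<and>
    (\<forall>(a :: nat) (b :: nat) (m :: nat) (n :: nat) (t :: real).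
       a > 0 \<and> b > 0 \<and> m > 0 \<and> n \<ge> 2 \<and>
       real a \<ge> 2 ^ 12 * (log 2 (real n)) ^ 3 \<and>
       (\<exists>(G :: nat ugraph) A B. mnab_graph m n a b A B G \<and> L_free F A B G) \<and>
       t = 2 ^ 8 * real n * (log 2 (real n)) ^ 2 / (real a * real b) \<longrightarrow>
       real (ramsey_number_real F t) \<ge> c * (real b * t / log 2 (real n)))"
proof (intro exI[of _ "1/1024"] conjI allI impI)
  fix a b m n :: nat and t :: real
  assume H: "a > 0 \<and> b > 0 \<and> m > 0 \<and> n \<ge> 2 \<and>
       real a \<ge> 2 ^ 12 * (log 2 (real n)) ^ 3 \<and>
       (\<exists>(G :: nat ugraph) A B. mnab_graph m n a b A B G \<and> L_free F A B G) \<and>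
       t = 2 ^ 8 * real n * (log 2 (real n)) ^ 2 / (real a * real b)"
  then have "real b * t / 1024 \<le> real (ramsey_number_real F t)"
    using ramsey_lower_bound[OF assms] by blast
  moreover have "real b * t / log 2 (real n) \<le> real b * t / 1"
  proof (rule divide_left_mono)
    show "1 \<le> log 2 (real n)" using H by (subst le_log_iff) auto
    then show "0 < log 2 (real n) * 1" by simp
    show "0 \<le> real b * t" using H by simp
  qed
  ultimately have "real b * t / log 2 (real n) \<le> 1024 * real (ramsey_number_real F t)"
    by simp
  from mult_left_mono[OF this, of "1/1024"]
  show "1/1024 * (real b * t / log 2 (real n)) \<le> real (ramsey_number_real F t)"
    by simp
qed simp

end
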